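(* For any integer $n\ge 2$, $Z_{DP}(n)\le n^2-\frac{n+3}{2}$.
   Context: All graphs are finite and simple; $\mathbb{N}$ is the set of non-negative integers; $\chi(G)$ is the chromatic number. For vertex-disjoint graphs $G_1,G_2$, the join $G_1\vee G_2$ has vertex set $V(G_1)\cup V(G_2)$ and edge set $E(G_1)\cup E(G_2)\cup\{v_1v_2: v_1\in V(G_1),v_2\in V(G_2)\}$. $K_m$ is the complete graph on $m$ vertices, and $G\vee K_0=G$. A cover of a graph $G$ is an ordered pair $\mathcal{H}=(L,H)$, where $H$ is a graph and $L$ is a mapping from $V(G)$ to the power set of $V(H)$ such that: (1) the sets $L(u)$, $u\in V(G)$, partition $V(H)$; (2) for every $u\in V(G)$, the induced subgraph $H[L(u)]$ is complete; (3) if $u\ne v$ are not adjacent in $G$, then there are no edges of $H$ between $L(u)$ and $L(v)$; (4) for each edge $uv\in E(G)$, the set of edges of $H$ between $L(u)$ and $L(v)$ is a (not necessarily perfect, possibly empty) matching. The cover is $m$-fold if $|L(v)|=m$ for all $v\in V(G)$. An $\mathcal{H}$-coloring of $G$ is an independent set in $H$ of size $|V(G)|$; $G$ is $\mathcal{H}$-colorable if it has an $\mathcal{H}$-coloring. The DP-chromatic number $\chi_{DP}(G)$ is the minimum positive integer $m$ such that $G$ is $\mathcal{H}$-colorable for each $m$-fold cover $\mathcal{H}$ of $G$. For a graph $G$, $Z_{DP}(G)=\min\{m\in\mathbb{N}: \chi_{DP}(G\vee K_m)=\chi(G\vee K_m)\}$. For $n\in\mathbb{N}$, $Z_{DP}(n)=\max\{Z_{DP}(G):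 G \text{ a graph with } |V(G)|=n\}$. *)

theory Defs
  imports Complex_Main "HOL-Library.Disjoint_Sets"
begin

record 'a sgraph =
  verts :: "'a set"
  edges :: "'a set set"

definition simple_graph :: "'a sgraph \<Rightarrow> bool" where
  "simple_graph G \<longleftrightarrow>
     finite (verts G) \<and> edges G \<subseteq> {e. e \<subseteq> verts G \<and> card e = 2}"

definition adjacent :: "'a sgraph \<Rightarrow> 'a \<Rightarrow> 'a \<Rightarrow> bool" where
  "adjacent G u v \<longleftrightarrow> {u, v} \<in> edges G"

definition is_complete :: "'a sgraph \<Rightarrow> bool" where
  "is_complete G \<longleftrightarrow> (\<forall>u\<in>verts G. \<forall>v\<in>verts G. u \<noteq> v \<longrightarrow> adjacent G u v)"

definition complete_graph :: "nat \<Rightarrow> nat sgraph" where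
  "complete_graph m = \<lparr>verts = {..<m}, edges = {e. e \<subseteq> {..<m} \<and> card e = 2}\<rparr>"

definition induced_subgraph :: "'a sgraph \<Rightarrow> 'a set \<Rightarrow> 'a sgraph" where
  "induced_subgraph G S = \<lparr>verts = verts G \<inter> S, edges = {e \<in> edges G. e \<subseteq> S}\<rparr>"

text \<open>Vertex-disjointness of the two operands is enforced by the sum type.\<close>

definition graph_join :: "'a sgraph \<Rightarrow> 'b sgraph \<Rightarrow> ('a + 'b) sgraph" where
  "graph_join G1 G2 =
     \<lparr>verts = verts G1 <+> verts G2,
      edges = (\<lambda>e. Inl ` e) ` edges G1 \<union> (\<lambda>e. Inr ` e) ` edges G2
              \<union> {{Inl u, Inr v} | u v. u \<in> verts G1 \<and> v \<in> verts G2}\<rparr>"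

definition proper_coloring :: "'a sgraph \<Rightarrow> nat \<Rightarrow> ('a \<Rightarrow> nat) \<Rightarrow> bool" where
  "proper_coloring G k c \<longleftrightarrow>
     c ` verts G \<subseteq> {..<k} \<and>
     (\<forall>u\<in>verts G. \<forall>v\<in>verts G. adjacent G u v \<longrightarrow> c u \<noteq> c v)"

definition chromatic_number :: "'a sgraph \<Rightarrow> nat" where
  "chromatic_number G = (LEAST k. \<exists>c. proper_coloring G k c)"

definition edges_between :: "'a sgraph \<Rightarrow> 'a set \<Rightarrow> 'a set \<Rightarrow> 'a set set" where
  "edges_between G A B = {{x, y} | x y. x \<in> A \<and> y \<in> B \<and> adjacent G x y}"

definition matching :: "'a set set \<Rightarrow> bool" where
  "matching M \<longleftrightarrow> pairwise disjnt M"

definition independent_set :: "'a sgraph \<Rightarrow> 'a set \<Rightarrow> bool" where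
  "independent_set G S \<longleftrightarrow> S \<subseteq> verts G \<and> (\<forall>u\<in>S. \<forall>v\<in>S. \<not> adjacent G u v)"

text \<open>Values of \<open>L\<close> outside the vertex set of \<open>G\<close> are irrelevant.\<close>

definition cover :: "'a sgraph \<Rightarrow> ('a \<Rightarrow> 'b set) \<times> 'b sgraph \<Rightarrow> bool" where
  "cover G = (\<lambda>(L, H).
     simple_graph H \<and>
     disjoint_family_on L (verts G) \<and> (\<Union>u\<in>verts G. L u) = verts H \<and>
     (\<forall>u\<in>verts G. is_complete (induced_subgraph H (L u))) \<and>
     (\<forall>u\<in>verts G. \<forall>v\<in>verts G. u \<noteq> v \<and> \<not> adjacent G u v \<longrightarrow>
        edges_between H (L u) (L v) = {}) \<and>
     (\<forall>u\<in>verts G. \<forall>v\<in>verts G. adjacent G u v \<longrightarrow>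
        matching (edges_between H (L u) (L v))))"

definition fold_cover :: "nat \<Rightarrow> 'a sgraph \<Rightarrow> ('a \<Rightarrow> 'b set) \<times> 'b sgraph \<Rightarrow> bool" where
  "fold_cover m G = (\<lambda>(L, H). cover G (L, H) \<and> (\<forall>v\<in>verts G. card (L v) = m))"

definition cover_colorable :: "'a sgraph \<Rightarrow> ('a \<Rightarrow> 'b set) \<times> 'b sgraph \<Rightarrow> bool" where
  "cover_colorable G = (\<lambda>(L, H). \<exists>S. independent_set H S \<and> card S = card (verts G))"

text \<open>
  HOL cannot quantify over the vertex type of a cover inside a definition. Cover graphs are
  finite, so up to isomorphism they all have natural numbers as vertices.
\<close>

definition DP_chromatic_number :: "'a sgraph \<Rightarrow> nat" where
  "DP_chromatic_number G =
     (LEAST m. 0 < m \<and>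
        (\<forall>\<H> :: ('a \<Rightarrow> nat set) \<times> nat sgraph. fold_cover m G \<H> \<longrightarrow> cover_colorable G \<H>))"

definition Z_DP :: "'a sgraph \<Rightarrow> nat" where
  "Z_DP G =
     (LEAST m. DP_chromatic_number (graph_join G (complete_graph m))
             = chromatic_number (graph_join G (complete_graph m)))"

text \<open>Again, every finite graph is isomorphic to one with natural numbers as vertices.\<close>

definition Z_DP_max :: "nat \<Rightarrow> nat" where
  "Z_DP_max n = Max {Z_DP G | G :: nat sgraph. simple_graph G \<and> card (verts G) = n}"

end

theory Submission imports Defs "HOL-Library.Countable" begin

text \<open>
  The heart of the matter is a criterion for colouring a graph \<open>G\<close> joined to a clique \<open>A\<close> from a
  cover. Give each \<open>v\<close> in \<open>V = V(G)\<close> the deficit \<open>max 0 (deg\<^sub>G v + |A| + 1 - |L v|)\<close>, the amount by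
  which its list is too short for \<open>v\<close> to be coloured greedily after everything else. If \<open>G\<close> is
  properly coloured with \<open>q\<close> classes, every list of a clique vertex has at least \<open>|A| + q\<close> elements,
  and the deficits sum to at most \<open>|A|\<close>, then a colouring exists (\<open>joined_lists_colorable\<close>).

  There are two ways to pay for deficits. Colouring a clique vertex with \<open>x\<close> costs one clique vertex,
  and lowers by one the deficit of each \<open>v\<close> such that \<open>x\<close> has no neighbour in \<open>L v\<close>. If \<open>x\<close> meets
  every list, it saves nothing by itself. But suppose that in addition nothing can be saved after
  \<open>x\<close> has been used. Then the neighbours of \<open>x\<close> in the lists of one colour class of \<open>G\<close> agree with \<open>x\<close>
  so well that each clique vertex loses at most one colour when the whole class is coloured with
  them (\<open>consistent_class\<close>). This removes a class, and with it a positive deficit, without using a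
  clique vertex. Otherwise using \<open>x\<close> opens the way to a saving, and the process may run one clique
  vertex in debt: whenever a colour that makes exactly one saving leads to a position without
  further savings, one does not use it, but colours a class that avoids the vertex saved, which
  clears the debt.

  For the theorem, let \<open>n = |V(G)|\<close>, let \<open>A\<close> have \<open>s = n (n - 2)\<close> vertices and let \<open>K\<close> be the chromatic
  number of the join. An optimal colouring of the join uses at most \<open>K - s\<close> colours on \<open>G\<close>. If it
  uses only one, \<open>G\<close> has no edges and no vertex has a deficit; if it uses at least two, each deficit
  is at most \<open>(n - 1) + s + 1 - (s + 2) = n - 2\<close>. So the criterion applies to every \<open>K\<close>-fold cover, and the
  DP-chromatic number is at most \<open>K\<close>. It is at least \<open>K\<close> because colouring from the cover
  that gives all vertices the same list is ordinary colouring. Hence \<open>Z_DP G \<le> n (n - 2)\<close>, which is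
  below the bound claimed.
\<close>

section \<open>Lists with matchings between them\<close>

text \<open>
  A cover, seen from the lists: \<open>g\<close> is adjacency of vertices, \<open>E\<close> conflict of colours. Unlike a
  cover, this notion passes to arbitrary sublists, so that it survives partial colouring.
\<close>

definition matched_lists ::
  "('v \<Rightarrow> 'v \<Rightarrow> bool) \<Rightarrow> ('c \<Rightarrow> 'c \<Rightarrow> bool) \<Rightarrow> 'v set \<Rightarrow> ('v \<Rightarrow> 'c set) \<Rightarrow> bool" where
  "matched_lists g E U L \<longleftrightarrow>
     (\<forall>u\<in>U. finite (L u)) \<and>
     (\<forall>u\<in>U. \<forall>w\<in>U. u \<noteq> w \<longrightarrow>
        (\<forall>x\<in>L u. \<forall>y\<in>L w. \<forall>z\<in>L w. E x y \<longrightarrow> E x z \<longrightarrow> y = z)) \<and>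
     (\<forall>u\<in>U. \<forall>w\<in>U. u \<noteq> w \<longrightarrow> \<not> g u w \<longrightarrow> (\<forall>x\<in>L u. \<forall>y\<in>L w. \<not> E x y))"

definition transversal :: "('c \<Rightarrow> 'c \<Rightarrow> bool) \<Rightarrow> 'v set \<Rightarrow> ('v \<Rightarrow> 'c set) \<Rightarrow> ('v \<Rightarrow> 'c) \<Rightarrow> bool" where
  "transversal E U L f \<longleftrightarrow>
     (\<forall>u\<in>U. f u \<in> L u) \<and> (\<forall>u\<in>U. \<forall>w\<in>U. u \<noteq> w \<longrightarrow> \<not> E (f u) (f w))"

definition misses :: "('c \<Rightarrow> 'c \<Rightarrow> bool) \<Rightarrow> 'c \<Rightarrow> 'c set \<Rightarrow> bool" where
  "misses E x S \<longleftrightarrow> (\<forall>y\<in>S. \<not> E x y)"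

definition residual :: "('c \<Rightarrow> 'c \<Rightarrow> bool) \<Rightarrow> 'c set \<Rightarrow> ('v \<Rightarrow> 'c set) \<Rightarrow> 'v \<Rightarrow> 'c set" where
  "residual E Y L w = {y \<in> L w. \<forall>x\<in>Y. \<not> E x y}"

text \<open>
  Here \<open>V\<close> is the vertex set of the graph and \<open>A\<close> the clique joined to it, so \<open>v\<close> has \<open>card A\<close>
  neighbours besides those in \<open>V\<close>. Truncated subtraction provides the maximum with zero.
\<close>

definition deficit ::
  "('v \<Rightarrow> 'v \<Rightarrow> bool) \<Rightarrow> 'v set \<Rightarrow> 'v set \<Rightarrow> ('v \<Rightarrow> 'c set) \<Rightarrow> 'v \<Rightarrow> nat" where
  "deficit g V A L v = Suc (card {u\<in>V. g u v} + card A) - card (L v)"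

text \<open>
  A position of the process that colours a join. The map \<open>c\<close> splits \<open>V\<close> into \<open>card (c ` V)\<close> independent
  classes; both this number and \<open>card A\<close> fall as vertices are coloured, and so does the length
  demanded of the lists of the clique.
\<close>

definition joined_lists ::
  "('v \<Rightarrow> 'v \<Rightarrow> bool) \<Rightarrow> ('c \<Rightarrow> 'c \<Rightarrow> bool) \<Rightarrow> ('v \<Rightarrow> 'k) \<Rightarrow> 'v set \<Rightarrow> 'v set \<Rightarrow> ('v \<Rightarrow> 'c set) \<Rightarrow> bool" where
  "joined_lists g E c V A L \<longleftrightarrow>
     finite V \<and> finite A \<and> V \<inter> A = {} \<and> symp E \<and> matched_lists g E (V \<union> A) L \<and>
     (\<forall>u\<in>V. \<forall>v\<in>V. g u v \<longrightarrow> c u \<noteq> c v) \<and>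
     (\<forall>a\<in>A. card A + card (c ` V) \<le> card (L a))"

definition has_saving ::
  "('v \<Rightarrow> 'v \<Rightarrow> bool) \<Rightarrow> ('c \<Rightarrow> 'c \<Rightarrow> bool) \<Rightarrow> 'v set \<Rightarrow> 'v set \<Rightarrow> ('v \<Rightarrow> 'c set) \<Rightarrow> bool" where
  "has_saving g E V A L \<longleftrightarrow>
     (\<exists>a\<in>A. \<exists>x\<in>L a. \<exists>v\<in>V. 0 < deficit g V A L v \<and> misses E x (L v))"

lemma has_savingI:
  "a \<in> A \<Longrightarrow> x \<in> L a \<Longrightarrow> v \<in> V \<Longrightarrow> 0 < deficit g V A L v \<Longrightarrow> misses E x (L v) \<Longrightarrow>
    has_saving g E V A L"
  unfolding has_saving_def by blast

lemma matched_lists_mono: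
  assumes "matched_lists g E U L" "U' \<subseteq> U" "\<And>u. u \<in> U' \<Longrightarrow> L' u \<subseteq> L u"
  shows "matched_lists g E U' L'"
proof -
  have fin: "\<forall>u\<in>U'. finite (L' u)"
    using assms unfolding matched_lists_def by (meson finite_subset subsetD)
  have un: "y = z" if "u \<in> U'" "w \<in> U'" "u \<noteq> w" "x \<in> L' u" "y \<in> L' w" "z \<in> L' w" "E x y" "E x z"
    for u w x y z
  proof -
    have "u \<in> U" "w \<in> U" "x \<in> L u" "y \<in> L w" "z \<in> L w" using that assms(2,3) by blast+
    then show ?thesis using assms(1) that unfolding matched_lists_def by blast
  qed
  have ne: "\<not> E x y" if "u \<in> U'" "w \<in> U'" "u \<noteq> w" "\<not> g u w" "x \<in> L' u" "y \<in> L' w" for u w x y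
  proof -
    have "u \<in> U" "w \<in> U" "x \<in> L u" "y \<in> L w" using that assms(2,3) by blast+
    then show ?thesis using assms(1) that unfolding matched_lists_def by blast
  qed
  show ?thesis unfolding matched_lists_def using fin un ne by blast
qed

lemma residual_subset: "residual E Y L w \<subseteq> L w"
  by (auto simp: residual_def)

text \<open>A colour in \<open>Y\<close> removes at most one element from a list to which it is matched.\<close>

lemma card_residual:
  assumes "finite Y" "finite (L w)"
    and un: "\<And>x y z. x \<in> Y \<Longrightarrow> y \<in> L w \<Longrightarrow> z \<in> L w \<Longrightarrow> E x y \<Longrightarrow> E x z \<Longrightarrow> y = z"
  shows "card (L w) \<le> card (residual E Y L w) + card {x\<in>Y. \<not> misses E x (L w)}"
proof -
  let ?h = "\<lambda>x. THE y. y \<in> L w \<and> E x y"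
  have "L w - residual E Y L w \<subseteq> ?h ` {x\<in>Y. \<not> misses E x (L w)}"
  proof
    fix y assume "y \<in> L w - residual E Y L w"
    then obtain x where x: "x \<in> Y" "E x y" "y \<in> L w" by (auto simp: residual_def)
    then have "?h x = y" using un by (intro the_equality) auto
    then show "y \<in> ?h ` {x\<in>Y. \<not> misses E x (L w)}" using x by (auto simp: misses_def)
  qed
  then have "card (L w - residual E Y L w) \<le> card {x\<in>Y. \<not> misses E x (L w)}"
    using assms(1) by (intro surj_card_le) auto
  moreover have "card (L w - residual E Y L w) = card (L w) - card (residual E Y L w)"
    using assms(2) residual_subset by (metis card_Diff_subset finite_subset)
  ultimately show ?thesis by linarith
qed

lemma transversal_extend:
  assumes E: "symp E" and f: "transversal E X L f"
    and h: "transversal E (U - X) (residual E (f ` X) L) h" and "X \<subseteq> U"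
  shows "transversal E U L (\<lambda>u. if u \<in> X then f u else h u)"
proof -
  have XX: "\<not> E (f u) (f w)" if "u \<in> X" "w \<in> X" "u \<noteq> w" for u w
    using f that by (auto simp: transversal_def)
  have hh: "\<not> E (h u) (h w)" if "u \<in> U - X" "w \<in> U - X" "u \<noteq> w" for u w
    using h that by (auto simp: transversal_def)
  have fh: "\<not> E (f u) (h w)" if "u \<in> X" "w \<in> U - X" for u w
    using h that by (auto simp: transversal_def residual_def)
  then have hf: "\<not> E (h w) (f u)" if "u \<in> X" "w \<in> U - X" for u w
    using that E by (meson sympD)
  have mem: "f u \<in> L u" if "u \<in> X" for u using f that by (auto simp: transversal_def)
  have mem': "h u \<in> L u" if "u \<in> U - X" for u
    using h that by (auto simp: transversal_def residual_def)
  show ?thesis unfolding transversal_def using XX hh fh hf mem mem' by simp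
qed

lemma joined_lists_matched:
  assumes "joined_lists g E c V A L" "u \<in> V \<union> A" "w \<in> V \<union> A" "u \<noteq> w"
    "x \<in> L u" "y \<in> L w" "z \<in> L w" "E x y" "E x z"
  shows "y = z"
proof -
  have "matched_lists g E (V \<union> A) L" using assms(1) by (simp add: joined_lists_def)
  then have "\<forall>y\<in>L w. \<forall>z\<in>L w. E x y \<longrightarrow> E x z \<longrightarrow> y = z"
    unfolding matched_lists_def using assms(2-5) by simp
  then show ?thesis using assms(6-9) by blast
qed

lemma joined_lists_adjacent:
  assumes "joined_lists g E c V A L" "u \<in> V \<union> A" "w \<in> V \<union> A" "u \<noteq> w"
    "x \<in> L u" "y \<in> L w" "E x y"
  shows "g u w"
proof (rule ccontr)
  assume n: "\<not> g u w"
  have "matched_lists g E (V \<union> A) L" using assms(1) by (simp add: joined_lists_def)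
  then have "\<forall>x\<in>L u. \<forall>y\<in>L w. \<not> E x y"
    unfolding matched_lists_def using assms(2-4) n by simp
  then show False using assms(5-7) by blast
qed

lemma joined_lists_fin:
  assumes "joined_lists g E c V A L" "u \<in> V \<union> A"
  shows "finite (L u)"
  using assms by (simp add: joined_lists_def matched_lists_def)

lemma joined_lists_delete:
  assumes "joined_lists g E c V A L"
  shows "joined_lists g E c (V - {v}) A L"
proof -
  have "card (c ` (V - {v})) \<le> card (c ` V)"
    using assms by (intro card_mono) (auto simp: joined_lists_def)
  moreover have "matched_lists g E (V - {v} \<union> A) L"
    by (rule matched_lists_mono[where L = L and U = "V \<union> A"])
      (use assms in \<open>auto simp: joined_lists_def\<close>)
  moreover have "card A + card (c ` (V - {v})) \<le> card (L a)" if "a \<in> A" for a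
  proof -
    have "card A + card (c ` V) \<le> card (L a)" using assms that by (auto simp: joined_lists_def)
    then show ?thesis using calculation(1) by linarith
  qed
  ultimately show ?thesis using assms unfolding joined_lists_def by blast
qed

lemma deficit_delete:
  assumes "finite V"
  shows "deficit g (V - {v}) A L u \<le> deficit g V A L u"
proof -
  have "card {w\<in>V - {v}. g w u} \<le> card {w\<in>V. g w u}" using assms by (intro card_mono) auto
  then show ?thesis unfolding deficit_def by linarith
qed

section \<open>Moves\<close>

text \<open>
  A vertex without deficit can be coloured after all others, so it may be deleted: each neighbour
  takes at most one colour from its list.
\<close>

lemma transversal_last:
  assumes J: "joined_lists g E c V A L" and v: "v \<in> V" and d: "deficit g V A L v = 0"
    and f: "transversal E (V - {v} \<union> A) L f"
  shows "\<exists>f. transversal E (V \<union> A) L f"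
proof -
  let ?X = "V - {v} \<union> A"
  have fin: "finite V" "finite A" "V \<inter> A = {}" and E: "symp E"
    using J by (auto simp: joined_lists_def)
  have "card (L v) \<le> card (residual E (f ` ?X) L v) + card {x\<in>f ` ?X. \<not> misses E x (L v)}"
  proof (rule card_residual)
    show "finite (L v)" using J v by (auto intro: joined_lists_fin)
    fix x y z assume "x \<in> f ` ?X" and yz: "y \<in> L v" "z \<in> L v" "E x y" "E x z"
    then obtain u where u: "u \<in> ?X" "x = f u" by blast
    then have "x \<in> L u" "u \<noteq> v" using f v fin by (auto simp: transversal_def)
    then show "y = z" using joined_lists_matched[OF J _ _ _ _ yz, of u] u v by blast
  qed (use fin in auto)
  moreover have "{x\<in>f ` ?X. \<not> misses E x (L v)} \<subseteq> f ` ({u\<in>V. g u v} \<union> A)"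
  proof
    fix x assume "x \<in> {x\<in>f ` ?X. \<not> misses E x (L v)}"
    then obtain u y where u: "u \<in> ?X" "x = f u" "y \<in> L v" "E x y" by (auto simp: misses_def)
    then have "x \<in> L u" "u \<noteq> v" using f v fin by (auto simp: transversal_def)
    then have "g u v"
      using joined_lists_adjacent[OF J, of u v] u v by blast
    then show "x \<in> f ` ({u\<in>V. g u v} \<union> A)" using u by auto
  qed
  then have "card {x\<in>f ` ?X. \<not> misses E x (L v)} \<le> card ({u\<in>V. g u v} \<union> A)"
    using fin by (intro surj_card_le) auto
  then have "card {x\<in>f ` ?X. \<not> misses E x (L v)} \<le> card {u\<in>V. g u v} + card A"
    using card_Un_le le_trans by blast
  ultimately have "0 < card (residual E (f ` ?X) L v)" using d unfolding deficit_def by linarith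
  then obtain y where y: "y \<in> residual E (f ` ?X) L v" by (metis card.empty equals0I less_nat_zero_code)
  have "V \<union> A - ?X = {v}" using v fin by auto
  then have "transversal E (V \<union> A - ?X) (residual E (f ` ?X) L) (\<lambda>_. y)"
    using y by (auto simp: transversal_def)
  from transversal_extend[OF E f this] show ?thesis by blast
qed

text \<open>
  Colouring a clique vertex shortens each list by at most one, just as much as \<open>card A\<close> shrinks. A
  deficit therefore stays the same where a colour is lost, and drops where none is.
\<close>

lemma color_clique_vertex:
  assumes J: "joined_lists g E c V A L" and a: "a \<in> A" and x: "x \<in> L a"
  defines "L' \<equiv> residual E {x} L"
  shows "joined_lists g E c V (A - {a}) L'"
    and "v \<in> V \<Longrightarrow> misses E x (L v) \<Longrightarrow> deficit g V (A - {a}) L' v = deficit g V A L v - 1"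
    and "v \<in> V \<Longrightarrow> card (L v) \<le> Suc (card (L' v))"
    and "v \<in> V \<Longrightarrow> \<not> misses E x (L v) \<Longrightarrow> deficit g V (A - {a}) L' v = deficit g V A L v"
    and "transversal E (V \<union> (A - {a})) L' h \<Longrightarrow> \<exists>f. transversal E (V \<union> A) L f"
proof -
  have fin: "finite V" "finite A" "V \<inter> A = {}" and E: "symp E"
    using J by (auto simp: joined_lists_def)
  have cA: "card A = Suc (card (A - {a}))" using fin a by (metis card_Suc_Diff1)
  have le: "card (L w) \<le> card (L' w) + card {z\<in>{x}. \<not> misses E z (L w)}"
    if "w \<in> V \<union> A" "w \<noteq> a" for w
    unfolding L'_def
  proof (rule card_residual)
    show "finite (L w)" using J that by (auto intro: joined_lists_fin)
  next
    fix u y z assume "u \<in> {x}" and yz: "y \<in> L w" "z \<in> L w" "E u y" "E u z"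
    then show "y = z" using joined_lists_matched[OF J _ _ _ _ yz, of a] a x that by blast
  qed simp
  have le1: "card (L w) \<le> Suc (card (L' w))" if "w \<in> V \<union> A" "w \<noteq> a" for w
  proof -
    have "card {z\<in>{x}. \<not> misses E z (L w)} \<le> card {x}" by (intro card_mono) auto
    then show ?thesis using le[OF that] by simp
  qed
  have va: "v \<noteq> a" if "v \<in> V" for v using that a fin by auto
  show "joined_lists g E c V (A - {a}) L'"
  proof -
    have "matched_lists g E (V \<union> (A - {a})) L'"
      unfolding L'_def by (rule matched_lists_mono[where L = L and U = "V \<union> A"])
        (use J in \<open>auto simp: joined_lists_def residual_subset\<close>)
    moreover have "card (A - {a}) + card (c ` V) \<le> card (L' b)" if "b \<in> A - {a}" for b
    proof -
      have "card A + card (c ` V) \<le> card (L b)" using J that by (auto simp: joined_lists_def)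
      then show ?thesis using le1[of b] that cA by simp
    qed
    ultimately show ?thesis using J unfolding joined_lists_def by blast
  qed
  show "card (L v) \<le> Suc (card (L' v))" if "v \<in> V" using le1 va that by blast
  show "deficit g V (A - {a}) L' v = deficit g V A L v - 1" if "v \<in> V" "misses E x (L v)"
  proof -
    have "L' v = L v" using that by (auto simp: L'_def residual_def misses_def)
    then show ?thesis unfolding deficit_def using cA by simp
  qed
  show "deficit g V (A - {a}) L' v = deficit g V A L v" if v: "v \<in> V" "\<not> misses E x (L v)"
  proof -
    have "L' v \<subset> L v" using v by (auto simp: L'_def residual_def misses_def)
    then have "card (L' v) < card (L v)" using J v by (intro psubset_card_mono) (auto intro: joined_lists_fin)
    then have "card (L v) = Suc (card (L' v))" using le1[of v] v va by fastforce
    then show ?thesis unfolding deficit_def using cA by simp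
  qed
  show "\<exists>f. transversal E (V \<union> A) L f" if h: "transversal E (V \<union> (A - {a})) L' h"
  proof -
    have "V \<union> A - {a} = V \<union> (A - {a})" using va by auto
    then have "transversal E (V \<union> A - {a}) (residual E ((\<lambda>_. x) ` {a}) L) h"
      using h by (simp add: L'_def)
    from transversal_extend[OF E _ this] show ?thesis using a x by (auto simp: transversal_def)
  qed
qed

text \<open>
  Colouring a whole class \<open>W\<close> leaves \<open>A\<close> intact. A vertex outside \<open>W\<close> loses at most one colour for each
  neighbour in \<open>W\<close>, and its degree falls by the number of these neighbours. The clique vertices are
  the danger; if each of them loses at most one colour, this is made good by the disappearance of a
  class.
\<close>

lemma color_class:
  assumes J: "joined_lists g E c V A L" and j: "j \<in> c ` V"
  defines "W \<equiv> {v\<in>V. c v = j}"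
  assumes y: "\<And>v. v \<in> W \<Longrightarrow> y v \<in> L v"
    and one: "\<And>b. b \<in> A \<Longrightarrow> \<exists>z. \<forall>x\<in>L b. (\<exists>v\<in>W. E (y v) x) \<longrightarrow> x = z"
  defines "L' \<equiv> residual E (y ` W) L"
  shows "joined_lists g E c (V - W) A L'"
    and "v \<in> V - W \<Longrightarrow> deficit g (V - W) A L' v \<le> deficit g V A L v"
    and "transversal E (V - W \<union> A) L' h \<Longrightarrow> \<exists>f. transversal E (V \<union> A) L f"
proof -
  have fin: "finite V" "finite A" "V \<inter> A = {}" and E: "symp E"
    using J by (auto simp: joined_lists_def)
  have WV: "W \<subseteq> V" and finW: "finite W" using fin by (auto simp: W_def)
  have cV: "card (c ` V) = Suc (card (c ` (V - W)))"
  proof -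
    have "c ` (V - W) = c ` V - {j}" by (auto simp: W_def)
    then show ?thesis using j fin by (metis card_Suc_Diff1 finite_imageI)
  qed
  have Ab: "card (L b) \<le> Suc (card (L' b))" if b: "b \<in> A" for b
  proof -
    obtain z where "\<forall>x\<in>L b. (\<exists>v\<in>W. E (y v) x) \<longrightarrow> x = z" using one[OF b] by blast
    then have "L b \<subseteq> insert z (L' b)" by (auto simp: L'_def residual_def)
    moreover have "finite (L' b)"
      using joined_lists_fin[OF J, of b] b residual_subset unfolding L'_def by (metis UnI2 finite_subset)
    ultimately have "card (L b) \<le> card (insert z (L' b))" by (intro card_mono) auto
    then show ?thesis using card_insert_le_m1 by (metis card_insert_if le_Suc_eq \<open>finite (L' b)\<close>)
  qed
  show "joined_lists g E c (V - W) A L'"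
  proof -
    have "matched_lists g E (V - W \<union> A) L'"
      unfolding L'_def by (rule matched_lists_mono[where L = L and U = "V \<union> A"])
        (use J in \<open>auto simp: joined_lists_def residual_subset\<close>)
    moreover have "card A + card (c ` (V - W)) \<le> card (L' b)" if "b \<in> A" for b
    proof -
      have "card A + card (c ` V) \<le> card (L b)" using J that by (auto simp: joined_lists_def)
      then show ?thesis using Ab[of b] that cV by simp
    qed
    ultimately show ?thesis using J unfolding joined_lists_def by blast
  qed
  show "deficit g (V - W) A L' v \<le> deficit g V A L v" if v: "v \<in> V - W"
  proof -
    have "card (L v) \<le> card (L' v) + card {x\<in>y ` W. \<not> misses E x (L v)}"
      unfolding L'_def
    proof (rule card_residual)
      show "finite (L v)" using J v by (auto intro: joined_lists_fin)
      fix x p q assume "x \<in> y ` W" and pq: "p \<in> L v" "q \<in> L v" "E x p" "E x q"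
      then obtain u where u: "u \<in> W" "x = y u" by blast
      then show "p = q" using joined_lists_matched[OF J _ _ _ _ pq, of u] y v WV by blast
    qed (use finW in auto)
    moreover have "{x\<in>y ` W. \<not> misses E x (L v)} \<subseteq> y ` {u\<in>W. g u v}"
    proof
      fix x assume "x \<in> {x\<in>y ` W. \<not> misses E x (L v)}"
      then obtain u p where u: "u \<in> W" "x = y u" "p \<in> L v" "E x p" by (auto simp: misses_def)
      then have "g u v"
        using joined_lists_adjacent[OF J, of u v] y v WV by blast
      then show "x \<in> y ` {u\<in>W. g u v}" using u by auto
    qed
    then have "card {x\<in>y ` W. \<not> misses E x (L v)} \<le> card {u\<in>W. g u v}"
      using finW by (intro surj_card_le) auto
    moreover have "card {u\<in>V. g u v} = card {u\<in>V - W. g u v} + card {u\<in>W. g u v}"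
    proof -
      have "{u\<in>V. g u v} = {u\<in>V - W. g u v} \<union> {u\<in>W. g u v}" using WV by auto
      then show ?thesis using fin finW by (simp add: card_Un_disjoint disjoint_iff)
    qed
    ultimately show ?thesis unfolding deficit_def by linarith
  qed
  show "\<exists>f. transversal E (V \<union> A) L f" if h: "transversal E (V - W \<union> A) L' h"
  proof -
    have eq: "V \<union> A - W = V - W \<union> A" using WV fin by auto
    have "\<not> E (y u) (y w)" if "u \<in> W" "w \<in> W" "u \<noteq> w" for u w
    proof -
      have "\<forall>u\<in>V. \<forall>v\<in>V. g u v \<longrightarrow> c u \<noteq> c v" using J by (simp add: joined_lists_def)
      then have "\<not> g u w" using that unfolding W_def by (metis (mono_tags, lifting) mem_Collect_eq)
      then show ?thesis
        using joined_lists_adjacent[OF J, of u w] that y WV by blast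
    qed
    then have "transversal E W L y" using y by (auto simp: transversal_def)
    from transversal_extend[OF E this, of "V \<union> A"] h show ?thesis
      using WV unfolding eq L'_def by blast
  qed
qed

text \<open>
  Let \<open>y v\<close> be the neighbour of \<open>x\<close> in \<open>L v\<close>. If a colour \<open>w\<close> of a clique vertex conflicts with \<open>y v\<close> but
  not with \<open>x\<close>, then \<open>w\<close> is still available after \<open>x\<close> has been used, while \<open>y v\<close>, its only neighbour in
  \<open>L v\<close>, is not; so \<open>w\<close> would make a saving at \<open>v\<close>. When no such saving exists, every colour in conflict with
  some \<open>y v\<close> conflicts with \<open>x\<close>, and each clique vertex has at most one of these.
\<close>

lemma consistent_class:
  assumes J: "joined_lists g E c V A L" and a: "a \<in> A" and x: "x \<in> L a" and W: "W \<subseteq> V"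
    and hit: "\<And>v. v \<in> W \<Longrightarrow> \<not> misses E x (L v)"
    and stuck: "\<And>b z v. b \<in> A - {a} \<Longrightarrow> z \<in> residual E {x} L b \<Longrightarrow> v \<in> W \<Longrightarrow>
                  \<not> misses E z (residual E {x} L v)"
  obtains y where "\<And>v. v \<in> W \<Longrightarrow> y v \<in> L v"
    and "\<And>b. b \<in> A \<Longrightarrow> \<exists>z. \<forall>w\<in>L b. (\<exists>v\<in>W. E (y v) w) \<longrightarrow> w = z"
proof -
  have E: "symp E" and disj: "V \<inter> A = {}" using J by (auto simp: joined_lists_def)
  from hit have "\<exists>y. \<forall>v\<in>W. y v \<in> L v \<and> E x (y v)"
    unfolding misses_def by (intro bchoice) auto
  then obtain y where y: "\<And>v. v \<in> W \<Longrightarrow> y v \<in> L v \<and> E x (y v)" by blast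
  have "\<exists>z. \<forall>w\<in>L b. (\<exists>v\<in>W. E (y v) w) \<longrightarrow> w = z" if b: "b \<in> A" for b
  proof (cases "b = a")
    case True
    have "w = x" if "w \<in> L b" "v \<in> W" "E (y v) w" for w v
      using joined_lists_matched[OF J, of v a "y v" w x] that y[of v] True a x W disj E
      by (auto simp: symp_def)
    then show ?thesis by blast
  next
    case False
    have "E x w" if w: "w \<in> L b" "v \<in> W" "E (y v) w" for w v
    proof (rule ccontr)
      assume n: "\<not> E x w"
      have vV: "v \<in> V" using w W by auto
      have "w \<in> residual E {x} L b" using w n by (simp add: residual_def)
      then have "\<not> misses E w (residual E {x} L v)" using stuck b False w by blast
      then obtain p where p: "p \<in> L v" "\<not> E x p" "E w p"
        by (auto simp: misses_def residual_def)
      have "E w (y v)" using w E by (auto simp: symp_def)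
      then have "p = y v"
        using joined_lists_matched[OF J, of b v w p "y v"] p w y[of v] b vV disj by blast
      then show False using p y w by blast
    qed
    then have "w = w'" if "w \<in> L b" "v \<in> W" "E (y v) w" "w' \<in> L b" "v' \<in> W" "E (y v') w'" for w v w' v'
      using joined_lists_matched[OF J, of a b x w w'] that a b x False by blast
    then show ?thesis by metis
  qed
  then show ?thesis using that y by blast
qed

text \<open>Without savings, the matching embeds the list of each clique vertex into \<open>L v\<close>.\<close>

lemma no_saving_list_card:
  assumes J: "joined_lists g E c V A L" and ns: "\<not> has_saving g E V A L"
    and a: "a \<in> A" and v: "v \<in> V" and d: "0 < deficit g V A L v"
  shows "card A + card (c ` V) \<le> card (L v)"
proof -
  have E: "symp E" and disj: "V \<inter> A = {}" using J by (auto simp: joined_lists_def)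
  have "\<forall>x\<in>L a. \<exists>y. y \<in> L v \<and> E x y" using ns a v d unfolding has_saving_def misses_def by blast
  then obtain p where p: "\<And>x. x \<in> L a \<Longrightarrow> p x \<in> L v \<and> E x (p x)" by metis
  have "inj_on p (L a)"
  proof (rule inj_onI)
    fix x z assume xz: "x \<in> L a" "z \<in> L a" "p x = p z"
    then have "E (p x) x" "E (p x) z" using p E by (metis sympD)+
    then show "x = z" using joined_lists_matched[OF J, of v a "p x" x z] xz p a v disj by blast
  qed
  then have "card (L a) \<le> card (L v)"
    using p joined_lists_fin[OF J, of v] v by (intro card_inj_on_le[of p]) auto
  then show ?thesis using J a by (fastforce simp: joined_lists_def)
qed

section \<open>A colouring criterion for joins with a clique\<close>

text \<open>
  The second alternative describes positions in debt, which the induction has to carry along. Its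
  middle condition is what makes a debt repayable: a single remaining class is independent, and
  there it forbids any deficit, so that as long as deficits remain, there is a class
  that avoids the vertex just saved. The condition holds when debt is first incurred, by
  \<open>no_saving_list_card\<close>, and colouring clique vertices preserves it.
\<close>

theorem joined_lists_colorable:
  assumes "joined_lists g E c V A L"
    and "(\<Sum>v\<in>V. deficit g V A L v) \<le> card A \<or>
      ((\<Sum>v\<in>V. deficit g V A L v) \<le> Suc (card A) \<and>
       (\<forall>v\<in>V. card A + card (c ` V) \<le> card (L v)) \<and> has_saving g E V A L)"
  shows "\<exists>f. transversal E (V \<union> A) L f"
  using assms
proof (induction "card V + card A" arbitrary: V A L rule: less_induct)
  case less
  note J = less.prems(1) and IH = less.hyps
  have fin: "finite V" "finite A" "V \<inter> A = {}" using J by (auto simp: joined_lists_def)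
  let ?s = "\<Sum>v\<in>V. deficit g V A L v"
  show ?case
  proof (cases "\<exists>v\<in>V. deficit g V A L v = 0")
    case True
    then obtain v where v: "v \<in> V" "deficit g V A L v = 0" by blast
    let ?V = "V - {v}"
    have le: "deficit g ?V A L u \<le> deficit g V A L u" for u using fin by (rule_tac deficit_delete)
    have s: "?s = (\<Sum>u\<in>?V. deficit g V A L u)" using fin v by (simp add: sum.remove)
    have "card (c ` ?V) \<le> card (c ` V)" using fin by (intro card_mono) auto
    then have lb: "\<forall>u\<in>?V. card A + card (c ` ?V) \<le> card (L u)"
      if "\<forall>u\<in>V. card A + card (c ` V) \<le> card (L u)" using that by fastforce
    \<comment> \<open>If deleting \<open>v\<close> destroys the last saving, it has removed the deficit of the vertex saved,
      and this clears the debt.\<close>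
    have "(\<Sum>u\<in>?V. deficit g ?V A L u) \<le> card A" if "has_saving g E V A L" "\<not> has_saving g E ?V A L"
      "?s \<le> Suc (card A)"
    proof -
      from that(1) obtain a x u where u: "a \<in> A" "x \<in> L a" "u \<in> V" "0 < deficit g V A L u" "misses E x (L u)"
        unfolding has_saving_def by blast
      then have "u \<in> ?V" using v by auto
      moreover from this have "\<not> 0 < deficit g ?V A L u"
        using that(2) u has_savingI[of a A x L u ?V g E] by blast
      ultimately have "(\<Sum>u\<in>?V. deficit g ?V A L u) < (\<Sum>u\<in>?V. deficit g V A L u)"
        using fin le u by (intro sum_strict_mono_ex1) (auto intro!: bexI[of _ u])
      then show ?thesis using s that(3) by linarith
    qed
    moreover have "(\<Sum>u\<in>?V. deficit g ?V A L u) \<le> ?s" unfolding s using le by (intro sum_mono)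
    ultimately have "(\<Sum>u\<in>?V. deficit g ?V A L u) \<le> card A \<or>
      ((\<Sum>u\<in>?V. deficit g ?V A L u) \<le> Suc (card A) \<and>
       (\<forall>v\<in>?V. card A + card (c ` ?V) \<le> card (L v)) \<and> has_saving g E ?V A L)"
      using less.prems(2) lb by linarith
    moreover have "card ?V + card A < card V + card A" using card_Diff1_less[OF fin(1) v(1)] by linarith
    ultimately obtain f where "transversal E (?V \<union> A) L f"
      using IH[of ?V A L] joined_lists_delete[OF J] by blast
    then show ?thesis using transversal_last[OF J v] by blast
  next
    case False
    then have pos: "0 < deficit g V A L v" if "v \<in> V" for v using that False by (metis gr0I)
    let ?R = "\<lambda>x. residual E {x} L"
    let ?s' = "\<lambda>a x. \<Sum>v\<in>V. deficit g V (A - {a}) (?R x) v"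
    have cA: "card A = Suc (card (A - {a}))" if "a \<in> A" for a using fin that by (metis card_Suc_Diff1)
    have total: "?s' a x + card {v\<in>V. misses E x (L v)} = ?s" if "a \<in> A" "x \<in> L a" for a x
    proof -
      have "(\<Sum>v\<in>V. deficit g V (A - {a}) (?R x) v + (if misses E x (L v) then 1 else 0)) = ?s"
      proof (rule sum.cong[OF refl])
        fix v assume v: "v \<in> V"
        show "deficit g V (A - {a}) (?R x) v + (if misses E x (L v) then 1 else 0) = deficit g V A L v"
          using color_clique_vertex(2,4)[OF J that v] pos[OF v] by auto
      qed
      then show ?thesis using fin by (simp add: sum.distrib sum.If_cases Int_def)
    qed
    have lists': "\<forall>v\<in>V. card (A - {a}) + card (c ` V) \<le> card (?R x v)"
      if "a \<in> A" "x \<in> L a" "\<forall>v\<in>V. card A + card (c ` V) \<le> card (L v)" for a x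
      using color_clique_vertex(3)[OF J that(1,2)] that(3) cA[OF that(1)] by fastforce
    have vertex_step: ?thesis if "a \<in> A" "x \<in> L a"
      and s: "?s' a x \<le> card (A - {a}) \<or>
        (?s' a x \<le> Suc (card (A - {a})) \<and> (\<forall>v\<in>V. card (A - {a}) + card (c ` V) \<le> card (?R x v)) \<and>
         has_saving g E V (A - {a}) (?R x))" for a x
    proof -
      have "card V + card (A - {a}) < card V + card A" using cA[OF that(1)] by linarith
      from IH[OF this color_clique_vertex(1)[OF J that(1,2)] s] show ?thesis
        using color_clique_vertex(5)[OF J that(1,2)] by blast
    qed
    have class_step: ?thesis if a: "a \<in> A" and x: "x \<in> L a" and j: "j \<in> c ` V"
      and hit: "\<And>v. v \<in> V \<Longrightarrow> c v = j \<Longrightarrow> \<not> misses E x (L v)"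
      and stuck: "\<not> has_saving g E V (A - {a}) (?R x)" and s: "?s \<le> Suc (card A)" for a x j
    proof -
      let ?W = "{v\<in>V. c v = j}"
      obtain y where y: "\<And>v. v \<in> ?W \<Longrightarrow> y v \<in> L v"
        "\<And>b. b \<in> A \<Longrightarrow> \<exists>z. \<forall>w\<in>L b. (\<exists>v\<in>?W. E (y v) w) \<longrightarrow> w = z"
      proof (rule consistent_class[OF J a x, of ?W])
        fix b z v assume "b \<in> A - {a}" "z \<in> ?R x b" and v: "v \<in> ?W"
        moreover have "0 < deficit g V (A - {a}) (?R x) v"
          using color_clique_vertex(4)[OF J a x, of v] hit v pos by auto
        ultimately show "\<not> misses E z (?R x v)"
          using stuck v has_savingI[of b "A - {a}" z "?R x" v V g E] by blast
      qed (use hit in auto)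
      let ?L = "residual E (y ` ?W) L"
      note cc = color_class[OF J j y]
      obtain w where w: "w \<in> ?W" using j by auto
      have "(\<Sum>v\<in>V - ?W. deficit g (V - ?W) A ?L v) \<le> (\<Sum>v\<in>V - ?W. deficit g V A L v)"
        using cc(2) by (intro sum_mono) blast
      also have "\<dots> \<le> (\<Sum>v\<in>V - {w}. deficit g V A L v)" using w fin by (intro sum_mono2) auto
      also have "\<dots> < ?s" using w fin pos[of w] by (simp add: sum.remove[of V w])
      finally have le: "(\<Sum>v\<in>V - ?W. deficit g (V - ?W) A ?L v) \<le> card A" using s by linarith
      have "card (V - ?W) < card V" using w fin by (intro psubset_card_mono) auto
      then have "card (V - ?W) + card A < card V + card A" by simp
      from IH[OF this cc(1)] le obtain h where "transversal E (V - ?W \<union> A) ?L h" by blast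
      then show ?thesis using cc(3) by blast
    qed
    show ?thesis
    proof (cases "has_saving g E V A L")
      case True
      then obtain a x v where a: "a \<in> A" "x \<in> L a" and v: "v \<in> V" "misses E x (L v)"
        unfolding has_saving_def by blast
      have m: "card {u\<in>V. misses E x (L u)} = Suc (card ({u\<in>V. misses E x (L u)} - {v}))"
        using v fin by (intro card_Suc_Diff1[symmetric]) auto
      show ?thesis
      proof (cases "?s \<le> card A \<or> {u\<in>V. misses E x (L u)} \<noteq> {v}")
        case True
        moreover have "0 < card ({u\<in>V. misses E x (L u)} - {v})" if "{u\<in>V. misses E x (L u)} \<noteq> {v}"
          using that v fin by (subst card_gt_0_iff) auto
        ultimately have "?s' a x \<le> card (A - {a})"
          using total[OF a] m cA[OF a(1)] less.prems(2) by linarith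
        then show ?thesis using vertex_step[OF a] by blast
      next
        case False
        \<comment> \<open>In debt, and \<open>x\<close> makes just one saving: use \<open>x\<close> only if a saving remains afterwards.\<close>
        then have s: "?s \<le> Suc (card A)" and lb: "\<forall>v\<in>V. card A + card (c ` V) \<le> card (L v)"
          and only: "{u\<in>V. misses E x (L u)} = {v}" using less.prems(2) by auto
        have "?s' a x \<le> Suc (card (A - {a}))" using total[OF a] m cA[OF a(1)] s by linarith
        then have chain: ?thesis if "has_saving g E V (A - {a}) (?R x)"
          using vertex_step[OF a] lists'[OF a lb] that by blast
        obtain j where j: "j \<in> c ` V" "j \<noteq> c v"
        proof (rule ccontr)
          assume "\<not> thesis"
          then have eq: "c ` V = {c v}" using that v by blast
          then have "c u = c v" if "u \<in> V" for u using that by auto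
          then have e: "{u\<in>V. g u v} = {}" using J v(1) unfolding joined_lists_def by blast
          have "card A + 1 \<le> card (L v)" using lb v eq by auto
          then show False using pos[OF v(1)] unfolding deficit_def e by simp
        qed
        have "\<not> misses E x (L u)" if u: "u \<in> V" "c u = j" for u
        proof
          assume "misses E x (L u)"
          then have "u \<in> {v}" using only u by blast
          then show False using j u by blast
        qed
        then show ?thesis using class_step[OF a j(1) _ _ s] chain by blast
      qed
    next
      case False
      then have s: "?s \<le> card A" using less.prems(2) by blast
      show ?thesis
      proof (cases "V = {} \<or> A = {}")
        case True
        show ?thesis
        proof (cases "A = {}")
          case True
          then have "?s = 0" using s by simp
          then have "V = {}" using pos fin by fastforce
          then show ?thesis using True by (auto simp: transversal_def)
        next
          case False
          then obtain a where a: "a \<in> A" by blast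
          then have "0 < card A" using fin by (auto simp: card_gt_0_iff)
          then have "L a \<noteq> {}" using J a unfolding joined_lists_def by fastforce
          then show ?thesis using vertex_step[OF a] True False by auto
        qed
      next
        case ne: False
        then obtain a v where a: "a \<in> A" and v: "v \<in> V" by blast
        then have "0 < card A" using fin by (auto simp: card_gt_0_iff)
        then have "L a \<noteq> {}" using J a unfolding joined_lists_def by fastforce
        then obtain x where x: "x \<in> L a" by blast
        \<comment> \<open>An arbitrary colour \<open>x\<close> saves nothing now; it either incurs the debt or makes a class
          consistent.\<close>
        have hit: "\<not> misses E x (L u)" if "u \<in> V" for u
          using False pos that a x unfolding has_saving_def by blast
        have lb: "\<forall>v\<in>V. card A + card (c ` V) \<le> card (L v)"
          using no_saving_list_card[OF J False a] pos by blast
        have "?s' a x \<le> Suc (card (A - {a}))" using total[OF a x] s cA[OF a] by linarith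
        then have ?thesis if "has_saving g E V (A - {a}) (?R x)"
          using vertex_step[OF a x] lists'[OF a x lb] that by blast
        moreover have "c v \<in> c ` V" using v by blast
        ultimately show ?thesis using class_step[OF a x, of "c v"] hit s by (meson le_SucI)
      qed
    qed
  qed
qed

section \<open>Covers and joins of graphs\<close>

lemma adjacent_sym: "adjacent G u v \<longleftrightarrow> adjacent G v u"
  by (simp add: adjacent_def insert_commute)

lemma adjacent_neq: "simple_graph G \<Longrightarrow> adjacent G u v \<Longrightarrow> u \<noteq> v"
  by (auto simp: simple_graph_def adjacent_def)

lemma matched_lists_cover:
  assumes cov: "cover G (L, H)"
  shows "matched_lists (adjacent G) (adjacent H) (verts G) L"
proof -
  have H: "simple_graph H" and un: "(\<Union>u\<in>verts G. L u) = verts H"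
    and none: "\<And>u w. u \<in> verts G \<Longrightarrow> w \<in> verts G \<Longrightarrow> u \<noteq> w \<Longrightarrow> \<not> adjacent G u w \<Longrightarrow>
      edges_between H (L u) (L w) = {}"
    and mat: "\<And>u w. u \<in> verts G \<Longrightarrow> w \<in> verts G \<Longrightarrow> adjacent G u w \<Longrightarrow>
      matching (edges_between H (L u) (L w))"
    using cov unfolding cover_def by auto
  have fin: "finite (L u)" if "u \<in> verts G" for u
  proof (rule finite_subset)
    show "L u \<subseteq> verts H" using un that by blast
    show "finite (verts H)" using H by (simp add: simple_graph_def)
  qed
  have ne: "\<not> adjacent H x y"
    if "u \<in> verts G" "w \<in> verts G" "u \<noteq> w" "\<not> adjacent G u w" "x \<in> L u" "y \<in> L w" for u w x y
    using none[OF that(1-4)] that(5,6) unfolding edges_between_def by blast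
  have "y = z"
    if u: "u \<in> verts G" and w: "w \<in> verts G" and uw: "u \<noteq> w" and x: "x \<in> L u"
      and y: "y \<in> L w" and z: "z \<in> L w" and xy: "adjacent H x y" and xz: "adjacent H x z"
    for u w x y z
  proof -
    have "adjacent G u w" using ne[OF u w uw _ x y] xy by blast
    then have "pairwise disjnt (edges_between H (L u) (L w))"
      using mat u w by (simp add: matching_def)
    moreover have "{x, y} \<in> edges_between H (L u) (L w)" "{x, z} \<in> edges_between H (L u) (L w)"
      using x y z xy xz unfolding edges_between_def by blast+
    moreover have "\<not> disjnt {x, y} {x, z}" by (simp add: disjnt_def)
    ultimately have "{x, y} = {x, z}" by (meson pairwiseD)
    then show ?thesis by (auto simp: doubleton_eq_iff)
  qed
  note unique = this
  show ?thesis
    unfolding matched_lists_def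
    by (intro conjI ballI impI) (rule fin unique ne; assumption)+
qed

lemma cover_colorable_transversal:
  assumes cov: "cover G (L, H)" and f: "transversal (adjacent H) (verts G) L f"
  shows "cover_colorable G (L, H)"
proof -
  have H: "simple_graph H" and un: "(\<Union>u\<in>verts G. L u) = verts H"
    and dj: "disjoint_family_on L (verts G)"
    using cov unfolding cover_def by auto
  have mem: "f u \<in> L u" if "u \<in> verts G" for u using f that by (auto simp: transversal_def)
  have "inj_on f (verts G)"
    using mem dj unfolding inj_on_def disjoint_family_on_def by (metis disjoint_iff)
  then have "card (f ` verts G) = card (verts G)" by (rule card_image)
  moreover have "independent_set H (f ` verts G)"
    unfolding independent_set_def
  proof (intro conjI ballI)
    show "f ` verts G \<subseteq> verts H" using mem un by blast
    fix p q assume "p \<in> f ` verts G" "q \<in> f ` verts G"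
    then obtain u w where uw: "u \<in> verts G" "p = f u" "w \<in> verts G" "q = f w" by blast
    show "\<not> adjacent H p q"
      using f uw adjacent_neq[OF H] unfolding transversal_def by metis
  qed
  ultimately show ?thesis unfolding cover_colorable_def by auto
qed

lemma simple_graph_complete_graph: "simple_graph (complete_graph m)"
  by (simp add: simple_graph_def complete_graph_def)

lemma simple_graph_join:
  assumes "simple_graph G" "simple_graph G'"
  shows "simple_graph (graph_join G G')"
proof -
  have "e \<subseteq> verts G <+> verts G' \<and> card e = 2" if "e \<in> edges (graph_join G G')" for e
  proof -
    from that consider (l) d where "d \<in> edges G" "e = Inl ` d" | (r) d where "d \<in> edges G'" "e = Inr ` d"
      | (lr) u v where "u \<in> verts G" "v \<in> verts G'" "e = {Inl u, Inr v}"
      unfolding graph_join_def by auto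
    then show ?thesis
    proof cases
      case l
      then have "d \<subseteq> verts G" "card d = 2" using assms by (auto simp: simple_graph_def)
      then show ?thesis using l by (auto simp: card_image)
    next
      case r
      then have "d \<subseteq> verts G'" "card d = 2" using assms by (auto simp: simple_graph_def)
      then show ?thesis using r by (auto simp: card_image)
    next
      case lr
      then show ?thesis by auto
    qed
  qed
  moreover have "finite (verts (graph_join G G'))"
    using assms by (simp add: graph_join_def simple_graph_def)
  moreover have "verts (graph_join G G') = verts G <+> verts G'" by (simp add: graph_join_def)
  ultimately show ?thesis unfolding simple_graph_def by blast
qed

lemma adjacent_join_Inl_Inr:
  "u \<in> verts G \<Longrightarrow> v \<in> verts G' \<Longrightarrow> adjacent (graph_join G G') (Inl u) (Inr v)"
  unfolding adjacent_def graph_join_def by auto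

lemma adjacent_join_complete_Inr:
  assumes "i < m" "j < m" "i \<noteq> j"
  shows "adjacent (graph_join G (complete_graph m)) (Inr i) (Inr j)"
proof -
  have "{i, j} \<in> edges (complete_graph m)" using assms by (auto simp: complete_graph_def)
  then have "Inr ` {i, j} \<in> (\<lambda>e. Inr ` e) ` edges (complete_graph m)" by (rule imageI)
  then have "Inr ` {i, j} \<in> edges (graph_join G (complete_graph m))"
    unfolding graph_join_def sgraph.select_convs by (rule UnI1[OF UnI2])
  then show ?thesis by (simp add: adjacent_def)
qed

lemma chromatic_number_coloring:
  assumes "simple_graph G"
  shows "\<exists>c. proper_coloring G (chromatic_number G) c"
proof -
  have "finite (verts G)" using assms by (simp add: simple_graph_def)
  then obtain c where c: "bij_betw c (verts G) {0..<card (verts G)}"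
    using ex_bij_betw_finite_nat by blast
  have "proper_coloring G (card (verts G)) c"
    unfolding proper_coloring_def
  proof (intro conjI ballI impI)
    show "c ` verts G \<subseteq> {..<card (verts G)}" using c by (auto simp: bij_betw_def)
    fix u v assume "u \<in> verts G" "v \<in> verts G" "adjacent G u v"
    then show "c u \<noteq> c v"
      using c adjacent_neq[OF assms] by (metis bij_betw_def inj_on_eq_iff)
  qed
  then show ?thesis
    unfolding chromatic_number_def
    using LeastI[of "\<lambda>k. \<exists>c. proper_coloring G k c" "card (verts G)"] by blast
qed

section \<open>Ordinary colouring as colouring from a cover\<close>

text \<open>
  The vertices of the cover are pairs of a vertex of \<open>G\<close> and one of \<open>m\<close> colours, and equal colours at
  adjacent vertices conflict. The pairs are encoded as natural numbers by \<open>to_nat\<close>.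
\<close>

definition product_cover :: "nat \<Rightarrow> 'a::countable sgraph \<Rightarrow> ('a \<Rightarrow> nat set) \<times> nat sgraph" where
  "product_cover m G =
     (\<lambda>u. (\<lambda>i. to_nat (u, i)) ` {..<m},
      \<lparr>verts = (\<Union>u\<in>verts G. (\<lambda>i. to_nat (u, i)) ` {..<m}),
       edges = {{to_nat (u, i), to_nat (v, j)} | u v i j.
         u \<in> verts G \<and> v \<in> verts G \<and> i < m \<and> j < m \<and>
         (u = v \<and> i \<noteq> j \<or> adjacent G u v \<and> i = j)}\<rparr>)"

lemma adjacent_product_cover:
  fixes u v :: "'a::countable" and i j :: nat
  shows "adjacent (snd (product_cover m G)) (to_nat (u, i)) (to_nat (v, j)) \<longleftrightarrow>
    u \<in> verts G \<and> v \<in> verts G \<and> i < m \<and> j < m \<and> (u = v \<and> i \<noteq> j \<or> adjacent G u v \<and> i = j)"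
proof -
  have "adjacent (snd (product_cover m G)) (to_nat (u, i)) (to_nat (v, j)) \<longleftrightarrow>
      {to_nat (u, i), to_nat (v, j)} \<in> edges (snd (product_cover m G))"
    by (simp add: adjacent_def)
  also have "\<dots> \<longleftrightarrow>
    u \<in> verts G \<and> v \<in> verts G \<and> i < m \<and> j < m \<and> (u = v \<and> i \<noteq> j \<or> adjacent G u v \<and> i = j)"
    using adjacent_sym[of G u v] by (auto simp: product_cover_def doubleton_eq_iff)
  finally show ?thesis .
qed

lemma fold_cover_product_cover:
  fixes G :: "'a::countable sgraph"
  assumes "simple_graph G"
  shows "fold_cover m G (product_cover m G)"
proof -
  obtain L H where LH: "product_cover m G = (L, H)" by fastforce
  have L: "L u = (\<lambda>i. to_nat (u, i)) ` {..<m}" for u using LH by (auto simp: product_cover_def)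
  have H: "H = snd (product_cover m G)" using LH by simp
  have vH: "verts H = (\<Union>u\<in>verts G. L u)" unfolding H by (simp add: product_cover_def L)
  have adj: "adjacent H (to_nat (u, i)) (to_nat (v, j)) \<longleftrightarrow>
    u \<in> verts G \<and> v \<in> verts G \<and> i < m \<and> j < m \<and> (u = v \<and> i \<noteq> j \<or> adjacent G u v \<and> i = j)"
    for u v i j
    using adjacent_product_cover[of m G] LH by simp
  have fin: "finite (verts G)" using assms by (simp add: simple_graph_def)
  have "e \<subseteq> verts H \<and> card e = 2" if "e \<in> edges H" for e
  proof -
    from that LH obtain u v i j where e: "e = {to_nat (u, i), to_nat (v, j)}"
      "u \<in> verts G" "v \<in> verts G" "i < m" "j < m" "u = v \<and> i \<noteq> j \<or> adjacent G u v \<and> i = j"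
      unfolding product_cover_def by auto
    then have "(u, i) \<noteq> (v, j)" using adjacent_neq[OF assms] by blast
    then have "card e = 2" using e by simp
    moreover have "e \<subseteq> verts H" using e by (auto simp: vH L)
    ultimately show ?thesis by blast
  qed
  moreover have "finite (verts H)" using fin by (simp add: vH L)
  ultimately have sH: "simple_graph H" by (auto simp: simple_graph_def)
  have dj: "disjoint_family_on L (verts G)" by (auto simp: disjoint_family_on_def L)
  have cL: "card (L u) = m" for u
  proof -
    have "inj_on (\<lambda>i. to_nat (u, i)) {..<m}" by (auto simp: inj_on_def)
    then show ?thesis by (simp add: L card_image)
  qed
  have comp: "is_complete (induced_subgraph H (L u))" if u: "u \<in> verts G" for u
    unfolding is_complete_def
  proof (intro ballI impI)
    fix p q assume pq: "p \<in> verts (induced_subgraph H (L u))" "q \<in> verts (induced_subgraph H (L u))" "p \<noteq> q"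
    then have "p \<in> L u" "q \<in> L u" by (auto simp: induced_subgraph_def)
    moreover from this have "adjacent H p q" using pq(3) u by (auto simp: L adj)
    ultimately show "adjacent (induced_subgraph H (L u)) p q"
      by (simp add: adjacent_def induced_subgraph_def)
  qed
  have none: "edges_between H (L u) (L v) = {}" if "u \<noteq> v" "\<not> adjacent G u v" for u v
    using that by (auto simp: edges_between_def L adj)
  have mat: "matching (edges_between H (L u) (L v))" if "adjacent G u v" for u v
  proof -
    have uv: "u \<noteq> v" using adjacent_neq[OF assms that] .
    have shape: "\<exists>i::nat. e = {to_nat (u, i), to_nat (v, i)}" if "e \<in> edges_between H (L u) (L v)" for e
      using that uv unfolding edges_between_def by (auto simp: L adj)
    show ?thesis unfolding matching_def
    proof (rule pairwiseI)
      fix d e assume "d \<in> edges_between H (L u) (L v)" "e \<in> edges_between H (L u) (L v)" "d \<noteq> e"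
      moreover from this obtain i j :: nat where "d = {to_nat (u, i), to_nat (v, i)}"
        "e = {to_nat (u, j), to_nat (v, j)}" using shape by metis
      ultimately show "disjnt d e" using uv by (auto simp: disjnt_def)
    qed
  qed
  show ?thesis
    unfolding LH fold_cover_def cover_def using sH dj vH comp none mat cL by auto
qed

text \<open>
  The independent set meets each list at most once, because lists are complete; having one element
  for each vertex, it meets each list exactly once and so names a colour for each vertex.
\<close>

lemma proper_coloring_product_cover:
  fixes G :: "'a::countable sgraph"
  assumes G: "simple_graph G" and col: "cover_colorable G (product_cover m G)"
  shows "\<exists>c. proper_coloring G m c"
proof -
  obtain L H where LH: "product_cover m G = (L, H)" by fastforce
  have L: "L u = (\<lambda>i. to_nat (u, i)) ` {..<m}" for u using LH by (auto simp: product_cover_def)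
  have H: "H = snd (product_cover m G)" using LH by simp
  have vH: "verts H = (\<Union>u\<in>verts G. L u)" unfolding H by (simp add: product_cover_def L)
  have adj: "adjacent H (to_nat (u, i)) (to_nat (v, j)) \<longleftrightarrow>
    u \<in> verts G \<and> v \<in> verts G \<and> i < m \<and> j < m \<and> (u = v \<and> i \<noteq> j \<or> adjacent G u v \<and> i = j)"
    for u v i j
    using adjacent_product_cover[of m G] LH by simp
  have fin: "finite (verts G)" using G by (simp add: simple_graph_def)
  obtain S where S: "independent_set H S" "card S = card (verts G)"
    using col unfolding LH cover_colorable_def by auto
  define owner where "owner = (\<lambda>p::nat. fst (from_nat p :: 'a \<times> nat))"
  have sub: "\<exists>u i. p = to_nat (u, i) \<and> u \<in> verts G \<and> i < m" if "p \<in> S" for p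
    using that S(1) by (auto simp: independent_set_def vH L)
  have inj: "inj_on owner S"
  proof (rule inj_onI)
    fix p q assume pq: "p \<in> S" "q \<in> S" "owner p = owner q"
    obtain u i v j where "p = to_nat (u, i)" "u \<in> verts G" "i < m" "q = to_nat (v, j)" "v \<in> verts G" "j < m"
      using sub pq by metis
    moreover have "\<not> adjacent H p q" using S(1) pq by (simp add: independent_set_def)
    ultimately show "p = q" using pq(3) by (auto simp: owner_def adj)
  qed
  have "owner ` S \<subseteq> verts G" using sub by (force simp: owner_def)
  then have "owner ` S = verts G"
    using fin S(2) inj by (intro card_subset_eq) (auto simp: card_image)
  then have "\<exists>i. i < m \<and> to_nat (u, i) \<in> S" if "u \<in> verts G" for u
    using that sub by (force simp: owner_def)
  then obtain c where c: "\<And>u. u \<in> verts G \<Longrightarrow> c u < m \<and> to_nat (u, c u) \<in> S" by metis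
  have "proper_coloring G m c"
    unfolding proper_coloring_def
  proof (intro conjI ballI impI)
    show "c ` verts G \<subseteq> {..<m}" using c by auto
    fix u v assume uv: "u \<in> verts G" "v \<in> verts G" "adjacent G u v"
    then have "\<not> adjacent H (to_nat (u, c u)) (to_nat (v, c v))"
      using S(1) c unfolding independent_set_def by blast
    then show "c u \<noteq> c v" using uv c by (auto simp: adj)
  qed
  then show ?thesis by blast
qed

lemma chromatic_number_le_of_DP:
  fixes G :: "'a::countable sgraph"
  assumes "simple_graph G"
    and "\<forall>\<H> :: ('a \<Rightarrow> nat set) \<times> nat sgraph. fold_cover m G \<H> \<longrightarrow> cover_colorable G \<H>"
  shows "chromatic_number G \<le> m"
  unfolding chromatic_number_def
  using assms fold_cover_product_cover proper_coloring_product_cover by (intro Least_le) blast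

section \<open>Joins with a large complete graph\<close>

text \<open>
  The colour classes of \<open>G\<close> for the criterion come from an optimal colouring \<open>c\<close> of the join. Since
  \<open>c\<close> spends \<open>s\<close> colours on the clique and none of them on \<open>G\<close>, lists of size \<open>K\<close> are long enough.
\<close>

theorem DP_chromatic_number_join_complete_graph:
  fixes G :: "nat sgraph"
  assumes G: "simple_graph G" and ne: "verts G \<noteq> {}"
    and s: "card (verts G) * (card (verts G) - 2) \<le> s"
  shows "DP_chromatic_number (graph_join G (complete_graph s)) =
    chromatic_number (graph_join G (complete_graph s))"
proof -
  let ?J = "graph_join G (complete_graph s)" and ?n = "card (verts G)"
  define K where "K = chromatic_number ?J"
  define V :: "(nat + nat) set" where "V = Inl ` verts G"
  define A :: "(nat + nat) set" where "A = Inr ` {..<s}"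
  have finG: "finite (verts G)" using G by (simp add: simple_graph_def)
  have J: "simple_graph ?J" using G simple_graph_complete_graph by (rule simple_graph_join)
  have VA: "verts ?J = V \<union> A" by (auto simp: V_def A_def graph_join_def complete_graph_def)
  have cA: "card A = s" and cV: "card V = ?n" by (simp_all add: A_def V_def card_image)
  have fin: "finite V" "finite A" "V \<inter> A = {}" using finG by (auto simp: V_def A_def)
  obtain c where c: "proper_coloring ?J K c" unfolding K_def using chromatic_number_coloring[OF J] by blast
  then have proper: "c u \<noteq> c v" if "u \<in> V \<union> A" "v \<in> V \<union> A" "adjacent ?J u v" for u v
    using that unfolding proper_coloring_def VA by blast
  have "inj_on c A"
  proof (rule inj_onI, rule ccontr)
    fix a b assume ab: "a \<in> A" "b \<in> A" "c a = c b" "a \<noteq> b"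
    then have "adjacent ?J a b" by (auto simp: A_def intro!: adjacent_join_complete_Inr)
    then show False using proper[of a b] ab by blast
  qed
  moreover have "c ` V \<inter> c ` A = {}"
  proof -
    have "adjacent ?J v a" if "v \<in> V" "a \<in> A" for v a
      using that adjacent_join_Inl_Inr[of _ G _ "complete_graph s"] by (auto simp: V_def A_def complete_graph_def)
    then have "c v \<noteq> c a" if "v \<in> V" "a \<in> A" for v a using proper[of v a] that by blast
    then show ?thesis by blast
  qed
  moreover have "card (c ` V \<union> c ` A) \<le> K"
  proof -
    have "c ` V \<union> c ` A \<subseteq> {..<K}" using c unfolding proper_coloring_def VA by blast
    then show ?thesis using card_mono[of "{..<K}"] by simp
  qed
  ultimately have K: "s + card (c ` V) \<le> K" using fin cA by (simp add: card_Un_disjoint card_image)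
  have q: "1 \<le> card (c ` V)" using ne fin by (simp add: V_def Suc_le_eq card_gt_0_iff)
  have "cover_colorable ?J \<H>" if "fold_cover K ?J \<H>" for \<H> :: "(nat + nat \<Rightarrow> nat set) \<times> nat sgraph"
  proof -
    obtain L H where LH: "\<H> = (L, H)" by fastforce
    have cov: "cover ?J (L, H)" and cL: "\<And>v. v \<in> V \<union> A \<Longrightarrow> card (L v) = K"
      using that unfolding LH fold_cover_def VA by auto
    have jl: "joined_lists (adjacent ?J) (adjacent H) c V A L"
      unfolding joined_lists_def
    proof (intro conjI)
      show "symp (adjacent H)" by (auto simp: symp_def adjacent_sym)
      show "matched_lists (adjacent ?J) (adjacent H) (V \<union> A) L"
        using matched_lists_cover[OF cov] by (simp add: VA)
      show "\<forall>a\<in>A. card A + card (c ` V) \<le> card (L a)" using cL K cA by simp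
    qed (use fin proper in auto)
    have "deficit (adjacent ?J) V A L v \<le> ?n - 2" if v: "v \<in> V" for v
    proof (cases "card (c ` V) = 1")
      case True
      then obtain k where "c ` V = {k}" by (auto simp: card_1_singleton_iff)
      then have "c u = c v" if "u \<in> V" for u using that v by (metis imageI singletonD)
      then have "{u\<in>V. adjacent ?J u v} = {}" using proper v by blast
      then have "card {u\<in>V. adjacent ?J u v} = 0" by (simp only: card.empty)
      moreover have "card (L v) = K" using cL v by blast
      ultimately show ?thesis using K True cA unfolding deficit_def by linarith
    next
      case False
      have "{u\<in>V. adjacent ?J u v} \<subseteq> V - {v}" using adjacent_neq[OF J] by blast
      then have "card {u\<in>V. adjacent ?J u v} \<le> ?n - 1"
        using v fin cV card_mono[of "V - {v}"] by fastforce
      moreover have "?n \<ge> 1" using ne finG by (simp add: Suc_le_eq card_gt_0_iff)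
      moreover have "card (L v) = K" "2 \<le> card (c ` V)" using cL v False q by auto
      ultimately show ?thesis using K cA unfolding deficit_def by linarith
    qed
    then have "(\<Sum>v\<in>V. deficit (adjacent ?J) V A L v) \<le> ?n * (?n - 2)"
      using sum_bounded_above[of V "deficit (adjacent ?J) V A L" "?n - 2"] cV by simp
    then have "(\<Sum>v\<in>V. deficit (adjacent ?J) V A L v) \<le> card A" using s cA by linarith
    then obtain f where "transversal (adjacent H) (V \<union> A) L f"
      using joined_lists_colorable[OF jl] by blast
    then show ?thesis using cover_colorable_transversal[OF cov] unfolding LH VA by blast
  qed
  then have "0 < K \<and> (\<forall>\<H> :: (nat + nat \<Rightarrow> nat set) \<times> nat sgraph.
      fold_cover K ?J \<H> \<longrightarrow> cover_colorable ?J \<H>)"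
    using K q by simp
  then show ?thesis
    unfolding DP_chromatic_number_def K_def[symmetric]
  proof (rule Least_equality)
    fix m assume "0 < m \<and> (\<forall>\<H> :: (nat + nat \<Rightarrow> nat set) \<times> nat sgraph.
      fold_cover m ?J \<H> \<longrightarrow> cover_colorable ?J \<H>)"
    then show "K \<le> m" unfolding K_def by (rule chromatic_number_le_of_DP[OF J conjunct2])
  qed
qed

theorem theorem10:
  fixes n :: nat
  assumes "n \<ge> 2"
  shows "real (Z_DP_max n) \<le> (real n)\<^sup>2 - (real n + 3) / 2"
proof -
  let ?S = "{Z_DP G | G :: nat sgraph. simple_graph G \<and> card (verts G) = n}"
  have le: "z \<le> n * (n - 2)" if "z \<in> ?S" for z
  proof -
    from that obtain G :: "nat sgraph" where G: "z = Z_DP G" "simple_graph G" "card (verts G) = n" by blast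
    then have "verts G \<noteq> {}" using assms by auto
    then show ?thesis
      unfolding G(1) Z_DP_def
      using DP_chromatic_number_join_complete_graph[OF G(2), of "n * (n - 2)"] G(3)
      by (intro Least_le) simp
  qed
  have "Z_DP (complete_graph n) \<in> ?S"
    using simple_graph_complete_graph[of n] by (auto simp: complete_graph_def intro!: exI[of _ "complete_graph n"])
  then have "?S \<noteq> {}" by blast
  moreover have "finite ?S" using le by (intro finite_subset[of ?S "{..n * (n - 2)}"]) auto
  ultimately have "Z_DP_max n \<le> n * (n - 2)" unfolding Z_DP_max_def using le by (intro Max.boundedI)
  then have "real (Z_DP_max n) \<le> real (n * (n - 2))" by (rule of_nat_mono)
  also have "\<dots> = (real n)\<^sup>2 - 2 * real n"
    using assms by (simp add: of_nat_diff algebra_simps power2_eq_square)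
  also have "\<dots> \<le> (real n)\<^sup>2 - (real n + 3) / 2" using assms by simp
  finally show ?thesis .
qed

end
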